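(* Let $\varphi:[0,1)\to(0,\infty)$ be a smoothly increasing function such that $1/\varphi$ is convex. Let $k$ be a positive integer and let $f$ be a harmonic mapping in $\mathbb{D}$. If $f$ is $\varphi$-normal, then $$\sup\left\{\frac{f^{\#(k)}(z)}{\varphi(|z|)^k}: z\in\mathbb{D}\right\}<\infty.$$
   Context: $\mathbb{D}$ is the open unit disk in $\mathbb{C}$. A complex-valued function $f$ on a simply connected domain $D\subseteq\mathbb{C}$ is a harmonic mapping if it has a canonical decomposition $f=h+\overline{g}$ with $h,g$ holomorphic in $D$ and $g(z_0)=0$ for some point $z_0\in D$. The spherical derivative of $f=h+\overline{g}$ is $$f^{\#}(z)=\frac{|h'(z)|+|g'(z)|}{1+|f(z)|^2},$$ and for a positive integer $k$ the extended spherical derivative is $$f^{\#(k)}(z)=\frac{|h^{(k)}(z)|+|g^{(k)}(z)|}{1+|f(z)|^{k+1}}.$$ An increasing function $\varphi:[0,1)\to(0,\infty)$ is called smoothly increasing if $\varphi(r)(1-r)\to\infty$ as $r\to1^-$ and $$\mathcal{R}_a(z):=\frac{\varphi(|a+z/\varphi(|a|)|)}{\varphi(|a|)}\to 1\quad\text{as } |a|\to1^-$$ uniformly for $z$ in compact subsets of $\mathbb{C}$. Given such a $\varphi$, a harmonic mapping $f$ in $\mathbb{D}$ is $\varphi$-normal if $\sup_{z\in\mathbb{D}} f^{\#}(z)/\varphi(|z|)<\infty$. *)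

theory Defs
  imports "HOL-Complex_Analysis.Complex_Analysis"
begin

definition canonical_decomposition ::
  "complex set \<Rightarrow> (complex \<Rightarrow> complex) \<Rightarrow> (complex \<Rightarrow> complex) \<Rightarrow> (complex \<Rightarrow> complex) \<Rightarrow> bool" where
  "canonical_decomposition D f h g \<longleftrightarrow>
     h holomorphic_on D \<and> g holomorphic_on D \<and> (\<exists>z0\<in>D. g z0 = 0) \<and>
     (\<forall>z\<in>D. f z = h z + cnj (g z))"

text \<open>Nonemptiness of \<open>D\<close> is implied by the existence of the zero \<open>z0\<close>, and
  connectedness by simple connectedness.\<close>

definition harmonic_mapping_on :: "(complex \<Rightarrow> complex) \<Rightarrow> complex set \<Rightarrow> bool" where
  "harmonic_mapping_on f D \<longleftrightarrow>
     open D \<and> simply_connected D \<and> (\<exists>h g. canonical_decomposition D f h g)"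

text \<open>A decomposition \<open>f = h + cnj g\<close> determines \<open>h\<close> and \<open>g\<close> only up to additive constants
  (the point \<open>z0\<close> is not prescribed). An arbitrary one is chosen here; only derivatives of \<open>h\<close> and
  \<open>g\<close> occur below, so the choice is immaterial, as \<open>spherical_deriv_eq\<close> and
  \<open>ext_spherical_deriv_eq\<close> show.\<close>

definition decomp :: "complex set \<Rightarrow> (complex \<Rightarrow> complex) \<Rightarrow> (complex \<Rightarrow> complex) \<times> (complex \<Rightarrow> complex)" where
  "decomp D f = (SOME p. canonical_decomposition D f (fst p) (snd p))"

definition hol_part :: "complex set \<Rightarrow> (complex \<Rightarrow> complex) \<Rightarrow> complex \<Rightarrow> complex" where
  "hol_part D f = fst (decomp D f)"

definition antihol_part :: "complex set \<Rightarrow> (complex \<Rightarrow> complex) \<Rightarrow> complex \<Rightarrow> complex" where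
  "antihol_part D f = snd (decomp D f)"

definition spherical_deriv :: "complex set \<Rightarrow> (complex \<Rightarrow> complex) \<Rightarrow> complex \<Rightarrow> real" where
  "spherical_deriv D f z =
     (cmod (deriv (hol_part D f) z) + cmod (deriv (antihol_part D f) z)) / (1 + (cmod (f z))\<^sup>2)"

definition ext_spherical_deriv :: "nat \<Rightarrow> complex set \<Rightarrow> (complex \<Rightarrow> complex) \<Rightarrow> complex \<Rightarrow> real" where
  "ext_spherical_deriv k D f z =
     (cmod ((deriv ^^ k) (hol_part D f) z) + cmod ((deriv ^^ k) (antihol_part D f) z))
       / (1 + cmod (f z) ^ (k + 1))"

text \<open>The values of \<open>\<phi>\<close> outside \<open>[0,1)\<close> are irrelevant: since \<open>\<phi> r * (1 - r)\<close> tends to infinity,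
  the point \<open>a + z / \<phi> (cmod a)\<close> lies in the unit disk for all \<open>z\<close> in a given compact set once
  \<open>cmod a\<close> is close enough to 1. The filter \<open>filtercomap cmod (at_left 1)\<close> expresses that \<open>cmod a\<close>
  tends to 1 from below.\<close>

definition smoothly_increasing :: "(real \<Rightarrow> real) \<Rightarrow> bool" where
  "smoothly_increasing \<phi> \<longleftrightarrow>
     (\<forall>r\<in>{0..<1}. \<phi> r > 0) \<and>
     mono_on {0..<1} \<phi> \<and>
     filterlim (\<lambda>r. \<phi> r * (1 - r)) at_top (at_left 1) \<and>
     (\<forall>K. compact K \<longrightarrow>
        uniform_limit K
          (\<lambda>(a::complex) z. \<phi> (cmod (a + z / complex_of_real (\<phi> (cmod a)))) / \<phi> (cmod a))
          (\<lambda>z. 1) (filtercomap cmod (at_left 1)))"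

definition phi_normal :: "(real \<Rightarrow> real) \<Rightarrow> (complex \<Rightarrow> complex) \<Rightarrow> bool" where
  "phi_normal \<phi> f \<longleftrightarrow>
     bdd_above ((\<lambda>z. spherical_deriv (ball 0 1) f z / \<phi> (cmod z)) ` ball 0 1)"

lemma decomp_canonical:
  assumes "canonical_decomposition D f h g"
  shows "canonical_decomposition D f (hol_part D f) (antihol_part D f)"
proof -
  have "canonical_decomposition D f (fst (h, g)) (snd (h, g))"
    using assms by simp
  then show ?thesis
    unfolding hol_part_def antihol_part_def decomp_def by (rule someI)
qed

lemma holomorphic_eq_cnj_imp_deriv_0:
  assumes "open D" "p holomorphic_on D" "q holomorphic_on D" "z \<in> D"
    and eq: "\<And>w. w \<in> D \<Longrightarrow> p w = cnj (q w)"
  shows "deriv p z = 0" "deriv q z = 0"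
proof -
  have p: "(p has_derivative (*) (deriv p z)) (at z)"
    using assms by (auto intro: holomorphic_derivI simp flip: has_field_derivative_def)
  have q: "(q has_derivative (*) (deriv q z)) (at z)"
    using assms by (auto intro: holomorphic_derivI simp flip: has_field_derivative_def)
  have "((\<lambda>w. cnj (q w)) has_derivative (\<lambda>w. cnj (deriv q z * w))) (at z)"
    by (rule has_derivative_cnj [OF q])
  then have "(p has_derivative (\<lambda>w. cnj (deriv q z * w))) (at z)"
    by (rule has_derivative_transform_within_open [OF _ \<open>open D\<close> \<open>z \<in> D\<close>]) (simp add: eq)
  with p have fe: "(*) (deriv p z) = (\<lambda>w. cnj (deriv q z * w))"
    by (rule has_derivative_unique)
  have "deriv p z = cnj (deriv q z)" "deriv p z * \<i> = cnj (deriv q z * \<i>)"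
    using fun_cong [OF fe, of 1] fun_cong [OF fe, of \<i>] by simp_all
  then show "deriv p z = 0" "deriv q z = 0"
    by (auto simp: complex_eq_iff)
qed

lemma canonical_decomposition_deriv_unique:
  assumes "open D" "canonical_decomposition D f h g" "canonical_decomposition D f h' g'" "z \<in> D"
  shows "deriv h z = deriv h' z" "deriv g z = deriv g' z"
proof -
  have hol: "h holomorphic_on D" "h' holomorphic_on D" "g holomorphic_on D" "g' holomorphic_on D"
    using assms by (auto simp: canonical_decomposition_def)
  have eq: "h w - h' w = cnj (g' w - g w)" if "w \<in> D" for w
  proof -
    have "h w + cnj (g w) = h' w + cnj (g' w)"
      using assms that unfolding canonical_decomposition_def by metis
    then show ?thesis by (simp add: algebra_simps)
  qed
  have dif: "h field_differentiable at z" "h' field_differentiable at z"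
    "g field_differentiable at z" "g' field_differentiable at z"
    using hol assms(1,4) by (auto intro: holomorphic_on_imp_differentiable_at)
  have "deriv (\<lambda>w. h w - h' w) z = 0" "deriv (\<lambda>w. g' w - g w) z = 0"
    by (rule holomorphic_eq_cnj_imp_deriv_0 [OF assms(1) _ _ assms(4) eq];
        auto intro: holomorphic_intros hol)+
  then show "deriv h z = deriv h' z" "deriv g z = deriv g' z"
    using dif by simp_all
qed

lemma canonical_decomposition_higher_deriv_unique:
  assumes "open D" "canonical_decomposition D f h g" "canonical_decomposition D f h' g'" "z \<in> D"
    and "0 < k"
  shows "(deriv ^^ k) h z = (deriv ^^ k) h' z" "(deriv ^^ k) g z = (deriv ^^ k) g' z"
proof -
  obtain n where k: "k = Suc n"
    using \<open>0 < k\<close> gr0_conv_Suc by auto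
  have ev: "eventually (\<lambda>w. w \<in> D) (nhds z)"
    using assms by (simp add: eventually_nhds_in_open)
  have "eventually (\<lambda>w. deriv h w = deriv h' w) (nhds z)"
       "eventually (\<lambda>w. deriv g w = deriv g' w) (nhds z)"
    by (rule eventually_mono [OF ev],
        use canonical_decomposition_deriv_unique [OF assms(1-3)] in simp)+
  then have "(deriv ^^ n) (deriv h) z = (deriv ^^ n) (deriv h') z"
       "(deriv ^^ n) (deriv g) z = (deriv ^^ n) (deriv g') z"
    by (auto intro: higher_deriv_cong_ev)
  then show "(deriv ^^ k) h z = (deriv ^^ k) h' z" "(deriv ^^ k) g z = (deriv ^^ k) g' z"
    by (simp_all add: k funpow_Suc_right del: funpow.simps)
qed

lemma spherical_deriv_eq:
  assumes "open D" "canonical_decomposition D f h g" "z \<in> D"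
  shows "spherical_deriv D f z = (cmod (deriv h z) + cmod (deriv g z)) / (1 + (cmod (f z))\<^sup>2)"
  using canonical_decomposition_deriv_unique
      [OF assms(1,2) decomp_canonical [OF assms(2)] assms(3)]
  by (simp add: spherical_deriv_def)

lemma ext_spherical_deriv_eq:
  assumes "open D" "canonical_decomposition D f h g" "z \<in> D" "0 < k"
  shows "ext_spherical_deriv k D f z =
     (cmod ((deriv ^^ k) h z) + cmod ((deriv ^^ k) g z)) / (1 + cmod (f z) ^ (k + 1))"
  using canonical_decomposition_higher_deriv_unique
      [OF assms(1,2) decomp_canonical [OF assms(2)] assms(3,4)]
  by (simp add: ext_spherical_deriv_def)

end

theory Submission imports Defs begin

text \<open>
  Write \<open>f = h + cnj g\<close> on the unit disc. Normality reads
  \<open>\<bar>h'\<bar> + \<bar>g'\<bar> \<le> M * \<phi> * (1 + \<bar>f\<bar>\<^sup>2)\<close>, a differential inequality for \<open>f\<close>. At a point \<open>a\<close> put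
  \<open>p = \<phi> \<bar>a\<bar>\<close> and \<open>A = 1 + \<bar>f a\<bar>\<close>. A solution of \<open>y' \<le> B * p * (1 + y\<^sup>2)\<close> needs a time of order
  \<open>1 / (B * p * A)\<close> to grow from \<open>A\<close> to \<open>2 * A\<close>, so \<open>\<bar>f\<bar> \<le> 2 * A\<close> on a disc about \<open>a\<close> of that radius
  (\<open>harmonic_growth_bound\<close>), provided that \<open>\<phi>\<close> stays comparable to \<open>p\<close> there. Hence \<open>h'\<close> and \<open>g'\<close>
  are of order \<open>B * p * A\<^sup>2\<close> on that disc, and Cauchy's inequality bounds their derivatives of
  order \<open>n\<close> by a multiple of \<open>p * A\<^sup>2 * (p * A) ^ n = p ^ (n + 1) * A ^ (n + 2)\<close>
  (\<open>higher_deriv_bound_of_spherical_bound\<close>). With \<open>k = n + 1\<close> this has exactly the homogeneity of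
  the claim, because \<open>A ^ (k + 1)\<close> is comparable to \<open>1 + \<bar>f a\<bar> ^ (k + 1)\<close>.

  The comparability of \<open>\<phi>\<close> with \<open>p\<close> on the disc of radius \<open>1 / p\<close> about \<open>a\<close> is what smooth increase
  gives, for \<open>\<bar>a\<bar>\<close> close to \<open>1\<close> (\<open>smoothly_increasing_comparable\<close>). The remaining \<open>a\<close> form a compact
  set, on which the derivatives of \<open>h\<close> and \<open>g\<close> are bounded by continuity.
\<close>

section \<open>Derivative estimates from the differential inequality\<close>

text \<open>
  The differential inequality prevents \<open>f\<close> from doubling too early. Follow a ray from \<open>a\<close> to the first
  point at which \<open>\<bar>f\<bar> = 2 * A\<close>: up to there \<open>\<bar>f\<bar> \<le> 2 * A\<close>, so the speed is at most
  \<open>N * (1 + 4 * A\<^sup>2) \<le> 5 * N * A\<^sup>2\<close>, and a length of at most \<open>s\<close> yields an increment of at most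
  \<open>5 * N * A\<^sup>2 * s \<le> A\<close>. This is less than the increment \<open>2 * A - \<bar>f a\<bar> = A + 1\<close> required.
\<close>

lemma harmonic_growth_bound:
  fixes h g :: "complex \<Rightarrow> complex" and a :: complex and N s :: real
  defines "A \<equiv> 1 + cmod (h a + cnj (g a))"
  assumes "open S" and h: "h holomorphic_on S" and g: "g holomorphic_on S"
    and sub: "cball a s \<subseteq> S"
    and "0 \<le> N"
    and bound: "\<And>w. w \<in> cball a s \<Longrightarrow>
       cmod (deriv h w) + cmod (deriv g w) \<le> N * (1 + (cmod (h w + cnj (g w)))\<^sup>2)"
    and small: "5 * N * A * s \<le> 1"
    and z: "z \<in> cball a s"
  shows "cmod (h z + cnj (g z)) \<le> 2 * A"
proof (rule ccontr)
  assume contra: "\<not> ?thesis"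
  define d where "d = z - a"
  define \<gamma> where "\<gamma> t = a + of_real t * d" for t :: real
  define u where "u t = h (\<gamma> t) + cnj (g (\<gamma> t))" for t
  have d: "cmod d \<le> s"
    using z by (simp add: d_def dist_norm norm_minus_commute)
  have s0: "0 \<le> s"
    using d norm_ge_zero[of d] by linarith
  have A1: "1 \<le> A"
    by (simp add: A_def)
  have in_ball: "\<gamma> t \<in> cball a s" if "t \<in> {0..1}" for t
  proof -
    have "cmod (of_real t * d) \<le> 1 * s"
      unfolding norm_mult using that d by (intro mult_mono) auto
    then show ?thesis by (simp add: \<gamma>_def dist_norm)
  qed
  have der: "(u has_derivative
      (\<lambda>x. deriv h (\<gamma> t) * (of_real x * d) + cnj (deriv g (\<gamma> t) * (of_real x * d)))) (at t)"
    if "t \<in> {0..1}" for t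
  proof -
    have mem: "\<gamma> t \<in> S" using in_ball[OF that] sub by blast
    have g0: "(\<gamma> has_derivative (\<lambda>x. of_real x * d)) (at t)"
      unfolding \<gamma>_def by (auto intro!: derivative_eq_intros)
    have *: "((\<lambda>t. F (\<gamma> t)) has_derivative (\<lambda>x. deriv F (\<gamma> t) * (of_real x * d))) (at t)"
      if "F holomorphic_on S" for F
      by (rule has_derivative_compose[OF g0])
        (use holomorphic_derivI[OF that \<open>open S\<close> mem] in \<open>simp add: has_field_derivative_def\<close>)
    show ?thesis
      unfolding u_def by (intro has_derivative_add has_derivative_cnj * h g)
  qed
  then have cont: "continuous_on {0..1} u"
    by (meson continuous_at_imp_continuous_on has_derivative_continuous)
  define T where "T = {t \<in> {0..1}. 2 * A \<le> cmod (u t)}"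
  have "compact T"
  proof -
    have "closed ({0..1} \<inter> (\<lambda>t. cmod (u t)) -` {2 * A..})"
      by (intro continuous_closed_preimage continuous_intros cont)
    also have "{0..1} \<inter> (\<lambda>t. cmod (u t)) -` {2 * A..} = T"
      by (auto simp: T_def)
    finally have "closed T" .
    moreover have "bounded T"
      by (rule bounded_subset[of "{0..1}"]) (auto simp: T_def)
    ultimately show ?thesis by (simp add: compact_eq_bounded_closed)
  qed
  moreover have "1 \<in> T"
    using contra by (simp add: T_def u_def \<gamma>_def d_def)
  ultimately obtain t0 where t0: "t0 \<in> T" "\<And>t. t \<in> T \<Longrightarrow> t0 \<le> t"
    using compact_attains_inf[of T] by blast
  have u0: "cmod (u 0) = A - 1"
    by (simp add: u_def \<gamma>_def A_def)
  have "t0 \<noteq> 0"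
    using t0(1) u0 A1 by (auto simp: T_def)
  then have t01: "0 < t0" "t0 \<le> 1"
    using t0(1) by (auto simp: T_def)
  obtain x where x: "0 < x" "x < t0"
    and "cmod (u t0 - u 0) \<le>
      cmod (deriv h (\<gamma> x) * (of_real (t0 - 0) * d) + cnj (deriv g (\<gamma> x) * (of_real (t0 - 0) * d)))"
  proof -
    have "\<exists>x\<in>{0<..<t0}. norm (u t0 - u 0) \<le> norm ((\<lambda>x. (\<lambda>y. deriv h (\<gamma> x) * (of_real y * d)
        + cnj (deriv g (\<gamma> x) * (of_real y * d)))) x (t0 - 0))"
      by (rule mvt_general[OF t01(1)])
        (use t01 in \<open>intro continuous_on_subset[OF cont] der; simp\<close>)+
    then show ?thesis using that by auto
  qed
  note this(3)
  also have "\<dots> \<le> cmod (deriv h (\<gamma> x) * (of_real (t0 - 0) * d))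
      + cmod (cnj (deriv g (\<gamma> x) * (of_real (t0 - 0) * d)))"
    by (rule norm_triangle_ineq)
  also have "\<dots> = (cmod (deriv h (\<gamma> x)) + cmod (deriv g (\<gamma> x))) * (t0 * cmod d)"
    using t01 by (simp add: norm_mult algebra_simps)
  also have "\<dots> \<le> (N * (1 + (cmod (u x))\<^sup>2)) * (1 * s)"
    using bound[OF in_ball, of x] x t01 d s0 \<open>0 \<le> N\<close>
    by (intro mult_mono) (auto simp: u_def)
  also have "\<dots> \<le> (N * (A\<^sup>2 + (2 * A)\<^sup>2)) * s"
  proof -
    have "cmod (u x) < 2 * A"
      using t0(2)[of x] x t01 by (force simp: T_def)
    then have "(cmod (u x))\<^sup>2 \<le> (2 * A)\<^sup>2" by (intro power_mono) auto
    moreover have "1 \<le> A\<^sup>2" using A1 by simp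
    ultimately show ?thesis
      using \<open>0 \<le> N\<close> s0 by (auto intro!: mult_mono mult_left_mono)
  qed
  also have "\<dots> = (5 * N * A * s) * A"
    by (simp add: power2_eq_square)
  also have "\<dots> \<le> A"
    using small A1 by (intro mult_left_le_one_le[of A]) (auto simp: \<open>0 \<le> N\<close> s0)
  finally have "cmod (u t0 - u 0) \<le> A" .
  moreover have "2 * A \<le> cmod (u t0)"
    using t0(1) by (simp add: T_def)
  ultimately show False
    using norm_triangle_ineq2[of "u t0" "u 0"] u0 by linarith
qed

text \<open>
  The parameter \<open>p\<close> is the scale \<open>\<phi> \<bar>a\<bar>\<close>: the hypothesis is needed only on the disc of radius \<open>1 / p\<close>.
  The growth bound applies on the smaller radius \<open>1 / (5 * B * p * A)\<close>; Cauchy's inequality for the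
  first derivatives on that circle loses one factor \<open>5 * B * p * A\<close> per differentiation.
\<close>

lemma higher_deriv_bound_of_spherical_bound:
  fixes h g :: "complex \<Rightarrow> complex" and a :: complex and B p :: real
  defines "A \<equiv> 1 + cmod (h a + cnj (g a))"
  assumes "open S" and h: "h holomorphic_on S" and g: "g holomorphic_on S"
    and sub: "cball a (1 / p) \<subseteq> S"
    and "1 \<le> B" "0 < p"
    and bound: "\<And>w. w \<in> cball a (1 / p) \<Longrightarrow>
       cmod (deriv h w) + cmod (deriv g w) \<le> B * p * (1 + (cmod (h w + cnj (g w)))\<^sup>2)"
  shows "cmod ((deriv ^^ Suc n) h a) + cmod ((deriv ^^ Suc n) g a)
    \<le> 2 * fact n * (5 * B * p) ^ Suc n * A ^ (n + 2)"
proof -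
  define s where "s = 1 / (5 * B * p * A)"
  have A1: "1 \<le> A"
    by (simp add: A_def)
  have BA: "1 \<le> 5 * B * A"
    using mult_mono[of 1 "5 * B" 1 A] \<open>1 \<le> B\<close> A1 by simp
  have s0: "0 < s"
    using \<open>1 \<le> B\<close> \<open>0 < p\<close> A1 by (simp add: s_def)
  have "0 < B * A"
    using \<open>1 \<le> B\<close> A1 by (intro mult_pos_pos) auto
  have "s = (1 / p) / (5 * B * A)"
    by (simp add: s_def)
  also have "\<dots> \<le> (1 / p) / 1"
    using BA \<open>0 < B * A\<close> \<open>0 < p\<close> by (intro divide_left_mono) (auto simp: mult_ac)
  finally have s: "cball a s \<subseteq> cball a (1 / p)" by auto
  have small: "5 * (B * p) * A * s \<le> 1"
    using \<open>1 \<le> B\<close> \<open>0 < p\<close> A1 by (simp add: s_def)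
  have f_bound: "cmod (h w + cnj (g w)) \<le> 2 * A" if "w \<in> cball a s" for w
    unfolding A_def
    by (rule harmonic_growth_bound[OF \<open>open S\<close> h g _ _ _ _ that, where N = "B * p"])
      (use s sub bound small \<open>1 \<le> B\<close> \<open>0 < p\<close> in \<open>auto simp: A_def\<close>)
  have first: "cmod (deriv h w) + cmod (deriv g w) \<le> 5 * B * p * A\<^sup>2" if "w \<in> cball a s" for w
  proof -
    have "(cmod (h w + cnj (g w)))\<^sup>2 \<le> (2 * A)\<^sup>2"
      using f_bound[OF that] by (intro power_mono) auto
    moreover have "1 \<le> A\<^sup>2" using A1 by simp
    ultimately have "1 + (cmod (h w + cnj (g w)))\<^sup>2 \<le> 5 * A\<^sup>2"
      by (simp add: power_mult_distrib)
    then have "B * p * (1 + (cmod (h w + cnj (g w)))\<^sup>2) \<le> B * p * (5 * A\<^sup>2)"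
      using \<open>1 \<le> B\<close> \<open>0 < p\<close> by (intro mult_left_mono) auto
    with bound[of w] that s show ?thesis by (auto simp: mult_ac)
  qed
  have cauchy: "cmod ((deriv ^^ Suc n) F a) \<le> fact n * (5 * B * p) ^ Suc n * A ^ (n + 2)"
    if F: "F holomorphic_on S"
      and le: "\<And>w. w \<in> cball a s \<Longrightarrow> cmod (deriv F w) \<le> 5 * B * p * A\<^sup>2" for F
  proof -
    have hol: "deriv F holomorphic_on S"
      by (rule holomorphic_deriv[OF F \<open>open S\<close>])
    have "cmod ((deriv ^^ n) (deriv F) a) \<le> fact n * (5 * B * p * A\<^sup>2) / s ^ n"
    proof (rule Cauchy_inequality)
      show "deriv F holomorphic_on ball a s"
        using holomorphic_on_subset[OF hol] s sub by (meson ball_subset_cball order_trans)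
      show "continuous_on (cball a s) (deriv F)"
        using holomorphic_on_subset[OF hol] s sub
        by (meson holomorphic_on_imp_continuous_on order_trans)
      show "cmod (deriv F x) \<le> 5 * B * p * A\<^sup>2" if "cmod (a - x) = s" for x
        using le[of x] that by (simp add: dist_norm)
    qed (use s0 in auto)
    also have "\<dots> = fact n * (5 * B * p * A\<^sup>2) * (5 * B * p * A) ^ n"
      by (simp add: s_def power_one_over)
    also have "\<dots> = fact n * (5 * B * p) ^ Suc n * A ^ (n + 2)"
      by (simp add: power_mult_distrib power_add power2_eq_square)
    finally show ?thesis
      by (simp add: funpow_Suc_right del: funpow.simps)
  qed
  have "cmod (deriv h w) \<le> 5 * B * p * A\<^sup>2" "cmod (deriv g w) \<le> 5 * B * p * A\<^sup>2"
    if "w \<in> cball a s" for w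
    using first[OF that] norm_ge_zero[of "deriv h w"] norm_ge_zero[of "deriv g w"] by linarith+
  from cauchy[OF h this(1)] cauchy[OF g this(2)] show ?thesis by simp
qed

section \<open>Comparability of smoothly increasing functions at nearby points\<close>

text \<open>
  The uniform convergence of the quotients is used on the closed unit disc only: \<open>w\<close> corresponds to the
  rescaled variable \<open>(w - a) * \<phi> \<bar>a\<bar>\<close>. The bound \<open>2\<close> could be any number above the limit \<open>1\<close>.
\<close>

lemma smoothly_increasing_comparable:
  assumes "smoothly_increasing \<phi>"
  obtains r where "r < 1"
    and "\<And>a w. r < cmod a \<Longrightarrow> cmod a < 1 \<Longrightarrow> w \<in> cball a (1 / \<phi> (cmod a)) \<Longrightarrow>
      w \<in> ball 0 1 \<and> \<phi> (cmod w) \<le> 2 * \<phi> (cmod a)"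
proof -
  have pos: "0 < \<phi> x" if "0 \<le> x" "x < 1" for x
    using assms that by (auto simp: smoothly_increasing_def)
  have "filterlim (\<lambda>r. \<phi> r * (1 - r)) at_top (at_left 1)"
    using assms by (simp add: smoothly_increasing_def)
  then have "eventually (\<lambda>r. 1 < \<phi> r * (1 - r)) (at_left 1)"
    by (simp add: filterlim_at_top_dense)
  then obtain r1 where r1: "r1 < 1" "\<And>x. r1 < x \<Longrightarrow> x < 1 \<Longrightarrow> 1 < \<phi> x * (1 - x)"
    by (auto simp: eventually_at_left_field)
  have "uniform_limit (cball 0 1)
      (\<lambda>(a::complex) z. \<phi> (cmod (a + z / complex_of_real (\<phi> (cmod a)))) / \<phi> (cmod a))
      (\<lambda>z. 1) (filtercomap cmod (at_left 1))"
    using assms compact_cball unfolding smoothly_increasing_def by blast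
  from uniform_limitD[OF this, of 1]
  obtain Q where Q: "eventually Q (at_left (1::real))"
    "\<And>a::complex. Q (cmod a) \<Longrightarrow>
      \<forall>z\<in>cball 0 1. dist (\<phi> (cmod (a + z / complex_of_real (\<phi> (cmod a)))) / \<phi> (cmod a)) 1 < 1"
    by (auto simp: eventually_filtercomap)
  from Q(1) obtain r2 where r2: "r2 < 1" "\<And>x. r2 < x \<Longrightarrow> x < 1 \<Longrightarrow> Q x"
    by (auto simp: eventually_at_left_field)
  show thesis
  proof (rule that[of "max r1 r2"])
    show "max r1 r2 < 1" using r1 r2 by simp
    fix a w :: complex
    assume a: "max r1 r2 < cmod a" "cmod a < 1" and w: "w \<in> cball a (1 / \<phi> (cmod a))"
    define p where "p = \<phi> (cmod a)"
    have p: "0 < p" using pos[of "cmod a"] a by (simp add: p_def)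
    have dist: "cmod (w - a) \<le> 1 / p"
      using w by (simp add: p_def dist_norm norm_minus_commute)
    have "1 / p < 1 - cmod a"
      using r1(2)[of "cmod a"] a p by (simp add: p_def field_simps)
    then have "cmod w < 1"
      using dist norm_triangle_ineq2[of w a] by linarith
    moreover have "\<phi> (cmod w) \<le> 2 * p"
    proof -
      define z where "z = (w - a) * of_real p"
      have "z \<in> cball 0 1"
        using dist p by (simp add: z_def norm_mult pos_le_divide_eq)
      moreover have "a + z / of_real p = w"
        using p by (simp add: z_def)
      ultimately have "dist (\<phi> (cmod w) / p) 1 < 1"
        using Q(2)[OF r2(2)[of "cmod a"]] a unfolding p_def by fastforce
      then have "\<phi> (cmod w) / p < 2"
        by (simp add: dist_real_def abs_less_iff)
      then show ?thesis using p by (simp add: field_simps)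
    qed
    ultimately show "w \<in> ball 0 1 \<and> \<phi> (cmod w) \<le> 2 * \<phi> (cmod a)"
      by (simp add: p_def)
  qed
qed

section \<open>Boundedness of the extended spherical derivatives\<close>

lemma one_plus_power_le:
  fixes x :: real
  assumes "0 \<le> x"
  shows "(1 + x) ^ m \<le> 2 ^ m * (1 + x ^ m)"
proof -
  have "(1 + x) ^ m \<le> (2 * max 1 x) ^ m"
    using assms by (intro power_mono) auto
  also have "\<dots> = 2 ^ m * (max 1 x) ^ m"
    by (simp add: power_mult_distrib)
  also have "\<dots> \<le> 2 ^ m * (1 + x ^ m)"
    using assms by (intro mult_left_mono) (auto simp: max_def)
  finally show ?thesis .
qed

theorem theorem1p7:
  fixes \<phi> :: "real \<Rightarrow> real" and f :: "complex \<Rightarrow> complex" and k :: nat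
  assumes "smoothly_increasing \<phi>"
    and "convex_on {0..<1} (\<lambda>r. 1 / \<phi> r)"
    and "0 < k"
    and "harmonic_mapping_on f (ball 0 1)"
    and "phi_normal \<phi> f"
  shows "bdd_above ((\<lambda>z. ext_spherical_deriv k (ball 0 1) f z / \<phi> (cmod z) ^ k) ` ball 0 1)"
proof -
  obtain n where k: "k = Suc n"
    using \<open>0 < k\<close> gr0_conv_Suc by auto
  define D :: "complex set" where "D = ball 0 1"
  have "open D" by (simp add: D_def)
  obtain h g where can: "canonical_decomposition D f h g"
    using assms(4) by (auto simp: harmonic_mapping_on_def D_def)
  then have h: "h holomorphic_on D" and g: "g holomorphic_on D"
    and f: "\<And>z. z \<in> D \<Longrightarrow> f z = h z + cnj (g z)"
    by (auto simp: canonical_decomposition_def)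
  have pos: "0 < \<phi> (cmod z)" if "z \<in> D" for z
    using assms(1) that by (simp add: smoothly_increasing_def D_def)
  define E where
    "E z = (cmod ((deriv ^^ k) h z) + cmod ((deriv ^^ k) g z)) / (1 + cmod (f z) ^ (k + 1))" for z
  have E: "ext_spherical_deriv k D f z = E z" if "z \<in> D" for z
    unfolding E_def using ext_spherical_deriv_eq[OF \<open>open D\<close> can that \<open>0 < k\<close>] .
  obtain M where M': "\<And>z. z \<in> D \<Longrightarrow> spherical_deriv D f z / \<phi> (cmod z) \<le> M"
    using assms(5) unfolding phi_normal_def bdd_above_def D_def by blast
  have normal: "spherical_deriv D f z \<le> M * \<phi> (cmod z)" if "z \<in> D" for z
    using M'[OF that] pos[OF that] by (simp add: pos_divide_le_eq)
  have M: "(cmod (deriv h z) + cmod (deriv g z)) / (1 + (cmod (f z))\<^sup>2) \<le> M * \<phi> (cmod z)"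
    if "z \<in> D" for z
    using normal[OF that] spherical_deriv_eq[OF \<open>open D\<close> can that] by simp
  \<comment> \<open>The factor \<open>2\<close> absorbs the variation of \<open>\<phi>\<close> over the disc of radius \<open>1 / \<phi> \<bar>a\<bar>\<close> about \<open>a\<close>;
    the maximum makes the constant at least \<open>1\<close>, so that the radius \<open>1 / (5 * B * p * A)\<close> of the
    growth estimate does not exceed \<open>1 / p\<close>.\<close>
  define B where "B = 2 * max 1 M"
  have B1: "1 \<le> B" by (simp add: B_def)
  obtain r where r: "r < 1"
    "\<And>a w. r < cmod a \<Longrightarrow> cmod a < 1 \<Longrightarrow> w \<in> cball a (1 / \<phi> (cmod a)) \<Longrightarrow>
      w \<in> ball 0 1 \<and> \<phi> (cmod w) \<le> 2 * \<phi> (cmod a)"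
    using smoothly_increasing_comparable[OF assms(1)] by blast

  define C where "C = 2 * fact n * (5 * B) ^ k * 2 ^ (k + 1)"
  have near: "E a / \<phi> (cmod a) ^ k \<le> C" if a: "a \<in> D" "r < cmod a" for a
  proof -
    define p where "p = \<phi> (cmod a)"
    have p: "0 < p" using pos[OF a(1)] by (simp add: p_def)
    have cmp: "w \<in> D \<and> \<phi> (cmod w) \<le> 2 * p" if "w \<in> cball a (1 / p)" for w
      using r(2)[of a w] a that by (simp add: D_def p_def)
    have bound: "cmod (deriv h w) + cmod (deriv g w) \<le> B * p * (1 + (cmod (h w + cnj (g w)))\<^sup>2)"
      if "w \<in> cball a (1 / p)" for w
    proof -
      have w: "w \<in> D" "\<phi> (cmod w) \<le> 2 * p" using cmp[OF that] by auto
      have "(cmod (deriv h w) + cmod (deriv g w)) / (1 + (cmod (f w))\<^sup>2) \<le> M * \<phi> (cmod w)"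
        by (rule M[OF w(1)])
      also have "\<dots> \<le> max 1 M * (2 * p)"
        using w pos[OF w(1)] by (intro mult_mono) auto
      finally have "(cmod (deriv h w) + cmod (deriv g w)) / (1 + (cmod (f w))\<^sup>2) \<le> B * p"
        by (simp add: B_def mult_ac)
      moreover have "0 < 1 + (cmod (f w))\<^sup>2"
        by (rule add_pos_nonneg) auto
      ultimately show ?thesis
        using f[OF w(1)] by (simp add: pos_divide_le_eq)
    qed
    have "cmod ((deriv ^^ k) h a) + cmod ((deriv ^^ k) g a)
        \<le> 2 * fact n * (5 * B * p) ^ k * (1 + cmod (f a)) ^ (k + 1)"
      unfolding k f[OF a(1)]
      using higher_deriv_bound_of_spherical_bound[OF \<open>open D\<close> h g _ _ p bound, where n = n]
        cmp B1 by (simp add: subset_iff del: funpow.simps)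
    also have "\<dots> \<le> 2 * fact n * (5 * B * p) ^ k * (2 ^ (k + 1) * (1 + cmod (f a) ^ (k + 1)))"
      using p by (intro mult_left_mono one_plus_power_le) (auto simp: B_def)
    also have "\<dots> = C * p ^ k * (1 + cmod (f a) ^ (k + 1))"
      by (simp add: C_def power_mult_distrib)
    finally have "E a \<le> C * p ^ k"
      unfolding E_def by (subst pos_divide_le_eq) (auto intro: add_pos_nonneg)
    then show ?thesis
      using p by (simp add: p_def pos_divide_le_eq)
  qed

  \<comment> \<open>Away from the boundary, compactness bounds the numerator of \<open>E\<close>, the denominator is at least
    \<open>1\<close>, and \<open>\<phi>\<close> is bounded below by \<open>\<phi> 0\<close> because it increases. For negative \<open>r\<close> the disc is
    empty.\<close>
  have "\<exists>C'. \<forall>z \<in> cball 0 r. E z / \<phi> (cmod z) ^ k \<le> C'"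
  proof -
    have sub: "cball 0 r \<subseteq> D" using r(1) by (auto simp: D_def)
    have "continuous_on (cball 0 r) (\<lambda>z. cmod ((deriv ^^ k) h z) + cmod ((deriv ^^ k) g z))"
      using holomorphic_on_subset[OF holomorphic_higher_deriv[OF _ \<open>open D\<close>] sub] h g
      by (intro continuous_intros holomorphic_on_imp_continuous_on) auto
    then have "compact ((\<lambda>z. cmod ((deriv ^^ k) h z) + cmod ((deriv ^^ k) g z)) ` cball 0 r)"
      by (rule compact_continuous_image) simp
    then obtain c where c:
      "\<And>z. z \<in> cball 0 r \<Longrightarrow> cmod ((deriv ^^ k) h z) + cmod ((deriv ^^ k) g z) \<le> c"
      using bounded_imp_bdd_above[OF compact_imp_bounded] by (fastforce simp: bdd_above_def)
    have "E z / \<phi> (cmod z) ^ k \<le> c / \<phi> 0 ^ k" if z: "z \<in> cball 0 r" for z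
    proof -
      have zD: "z \<in> D" using z sub by blast
      have "0 < \<phi> 0" using pos[of 0] by (simp add: D_def)
      have "\<phi> 0 \<le> \<phi> (cmod z)"
        using assms(1) zD unfolding smoothly_increasing_def D_def
        by (auto elim!: mono_onD)
      have "0 \<le> c"
        using c[OF z] by (meson add_nonneg_nonneg norm_ge_zero order_trans)
      have "E z \<le> c / 1"
        unfolding E_def using c[OF z] \<open>0 \<le> c\<close> by (intro frac_le) auto
      then show ?thesis
        using \<open>0 \<le> c\<close> \<open>0 < \<phi> 0\<close> \<open>\<phi> 0 \<le> \<phi> (cmod z)\<close> by (intro frac_le power_mono) auto
    qed
    then show ?thesis by blast
  qed
  then obtain C' where far: "\<And>z. z \<in> cball 0 r \<Longrightarrow> E z / \<phi> (cmod z) ^ k \<le> C'" by blast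
  have "ext_spherical_deriv k D f z / \<phi> (cmod z) ^ k \<le> max C C'" if "z \<in> D" for z
    using near[OF that] far[of z] E[OF that] by (cases "r < cmod z") auto
  then show ?thesis
    unfolding D_def bdd_above_def by blast
qed

end
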